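(* Let $f(\mathbf z)$ be a convenient non-degenerate homogeneous polynomial of degree $d>0$ in $n\ge2$ variables, let $a>b\ge0$ be integers, and let $g(\mathbf w,\bar{\mathbf w})=f(w_1^a\bar w_1^b,\dots,w_n^a\bar w_n^b)$. For every $r>0$, let $K_r=g^{-1}(0)\cap\mathbb S_r$ and $\theta=\arg g:\mathbb S_r\setminus K_r\to S^1$ (the Milnor open book $g/|g|$). Then for every $r>0$ the canonical contact form $\alpha$ on $\mathbb S_r$ (with $\omega=d\alpha$) is adapted to (carried by) the Milnor open book $(K_r,\theta)$.
   Context: $\mathbb S_r=\{\sum|w_j|^2=r^2\}$, $\alpha=2\sum_j(x_jdy_j-y_jdx_j)=-i\sum_j(\bar w_jdw_j-w_jd\bar w_j)$, $\omega=d\alpha$, Reeb field $R(\mathbf w)=i\mathbf w/(2r^2)$ (i.e. $\frac{i}{2r^2}\sum_j(w_j\partial_{w_j}-\bar w_j\partial_{\bar w_j})$). Convenient/non-degenerate: the Newton boundary of $f$ meets every coordinate axis and each face function $f_P$ ($P$ a positive weight vector) has no critical point on $f_P^{-1}(0)\cap(\mathbb C^* )^n$. An open book on an oriented $(2n-1)$-manifold $M$ is a pair $(N,\theta)$ with $N$ a codimension-two submanifold with trivial normal bundle and $\theta:M\setminus N\to S^1$ a locally trivial fibration agreeing with the angular coordinate on a tubular neighborhood $N\times D_\delta$. A contact form $\alpha$ is carried by $(N,\theta)$ if (1) $\alpha|_N$ is a contact form on $N$, (2) $d\alpha$ is a symplectic form on every fiber $\theta^{-1}(\eta)$ (equivalently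 $d\theta(R)>0$), and (3) the orientation of $N$ induced by $\alpha$ agrees with its orientation as boundary of the fibers. *)

theory Defs
  imports "HOL-Analysis.Analysis"
begin

definition monomial_val :: "nat^'n \<Rightarrow> complex^'n \<Rightarrow> complex" where
  "monomial_val \<nu> z = (\<Prod>j\<in>UNIV. (z$j) ^ (\<nu>$j))"

definition coeff_supp :: "(nat^'n \<Rightarrow> complex) \<Rightarrow> (nat^'n) set" where
  "coeff_supp c = {\<nu>. c \<nu> \<noteq> 0}"

definition peval :: "(nat^'n \<Rightarrow> complex) \<Rightarrow> complex^'n \<Rightarrow> complex" where
  "peval c z = (\<Sum>\<nu>\<in>coeff_supp c. c \<nu> * monomial_val \<nu> z)"

definition total_deg :: "nat^'n \<Rightarrow> nat" where
  "total_deg \<nu> = (\<Sum>j\<in>UNIV. \<nu>$j)"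

definition homogeneous_poly :: "(nat^'n \<Rightarrow> complex) \<Rightarrow> nat \<Rightarrow> bool" where
  "homogeneous_poly c d \<longleftrightarrow> finite (coeff_supp c) \<and> (\<forall>\<nu>\<in>coeff_supp c. total_deg \<nu> = d)"

text \<open>Convenient: the Newton boundary meets every coordinate axis, i.e. for every
  coordinate j some pure power z_j^m occurs with non-zero coefficient.\<close>
definition convenient :: "(nat^'n \<Rightarrow> complex) \<Rightarrow> bool" where
  "convenient c \<longleftrightarrow> (\<forall>j. \<exists>m. c (\<chi> k. if k = j then m else 0) \<noteq> 0)"

definition wdeg :: "nat^'n \<Rightarrow> nat^'n \<Rightarrow> nat" where
  "wdeg P \<nu> = (\<Sum>j\<in>UNIV. P$j * \<nu>$j)"

definition face_poly :: "nat^'n \<Rightarrow> (nat^'n \<Rightarrow> complex) \<Rightarrow> (nat^'n \<Rightarrow> complex)" where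
  "face_poly P c = (\<lambda>\<nu>. if \<nu> \<in> coeff_supp c \<and> wdeg P \<nu> = Min (wdeg P ` coeff_supp c)
                        then c \<nu> else 0)"

definition nondegenerate :: "(nat^'n \<Rightarrow> complex) \<Rightarrow> bool" where
  "nondegenerate c \<longleftrightarrow>
     (\<forall>P::nat^'n. (\<forall>j. P$j > 0) \<longrightarrow>
        \<not> (\<exists>z. (\<forall>j. z$j \<noteq> 0) \<and> peval (face_poly P c) z = 0 \<and>
              (peval (face_poly P c) has_derivative (\<lambda>_. 0)) (at z)))"

definition gmix :: "nat \<Rightarrow> nat \<Rightarrow> (nat^'n \<Rightarrow> complex) \<Rightarrow> complex^'n \<Rightarrow> complex" where
  "gmix a b c w = peval c (\<chi> j. (w$j)^a * (cnj (w$j))^b)"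

text \<open>alpha = 2 sum (x_j dy_j - y_j dx_j), evaluated at base point p on the vector v.\<close>
definition alpha :: "complex^'n \<Rightarrow> complex^'n \<Rightarrow> real" where
  "alpha p v = 2 * (\<Sum>j\<in>UNIV. Im (cnj (p$j) * v$j))"

text \<open>omega = d alpha = 4 sum dx_j /\ dy_j (a constant 2-form).\<close>
definition omega :: "complex^'n \<Rightarrow> complex^'n \<Rightarrow> real" where
  "omega u v = 4 * (\<Sum>j\<in>UNIV. Im (cnj (u$j) * v$j))"

definition reeb :: "real \<Rightarrow> complex^'n \<Rightarrow> complex^'n" where
  "reeb r w = (\<chi> j. \<i> * w$j / complex_of_real (2 * r\<^sup>2))"

text \<open>Positive multiples of (alpha /\ omega^k)(v_0,...,v_2k) at p and of
  omega^k(v_0,...,v_{2k-1}) (alternation over all permutations); only signs and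
  (non)vanishing are used below.\<close>
definition alpha_omega_pow :: "nat \<Rightarrow> complex^'n \<Rightarrow> (nat \<Rightarrow> complex^'n) \<Rightarrow> real" where
  "alpha_omega_pow k p vs =
     (\<Sum>\<sigma>\<in>{\<sigma>. \<sigma> permutes {..2*k}}. of_int (sign \<sigma>) * alpha p (vs (\<sigma> 0)) *
         (\<Prod>i<k. omega (vs (\<sigma> (2*i+1))) (vs (\<sigma> (2*i+2)))))"

definition omega_pow :: "nat \<Rightarrow> (nat \<Rightarrow> complex^'n) \<Rightarrow> real" where
  "omega_pow k vs =
     (\<Sum>\<sigma>\<in>{\<sigma>. \<sigma> permutes {..<2*k}}. of_int (sign \<sigma>) *
         (\<Prod>i<k. omega (vs (\<sigma> (2*i))) (vs (\<sigma> (2*i+1)))))"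

definition binding :: "(complex^'n \<Rightarrow> complex) \<Rightarrow> real \<Rightarrow> (complex^'n) set" where
  "binding g r = {w \<in> sphere 0 r. g w = 0}"

definition theta :: "(complex^'n \<Rightarrow> complex) \<Rightarrow> complex^'n \<Rightarrow> complex" where
  "theta g w = g w / complex_of_real (cmod (g w))"

text \<open>p is a regular point of the map (|w|^2, g) : C^n \<rightarrow> R x C (so that K_r is a
  smooth codimension-two submanifold of S_r near p).\<close>
definition regular_binding_pt :: "(complex^'n \<Rightarrow> complex) \<Rightarrow> complex^'n \<Rightarrow> bool" where
  "regular_binding_pt g p \<longleftrightarrow> g differentiable (at p) \<and>
     (\<forall>t::real. \<forall>z::complex. \<exists>v. inner p v = t \<and> frechet_derivative g (at p) v = z)"

definition tangent_binding :: "(complex^'n \<Rightarrow> complex) \<Rightarrow> complex^'n \<Rightarrow> (complex^'n) set" where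
  "tangent_binding g p = {v. inner p v = 0 \<and> frechet_derivative g (at p) v = 0}"

text \<open>Condition (1): alpha restricted to K_r is a contact form on the (2n-3)-manifold K_r,
  i.e. alpha /\ (d alpha)^(n-2) is nowhere zero on K_r.\<close>
definition carry_cond1 :: "(complex^'n \<Rightarrow> complex) \<Rightarrow> real \<Rightarrow> bool" where
  "carry_cond1 g r \<longleftrightarrow>
     (\<forall>p \<in> binding g r. regular_binding_pt g p \<and>
        (\<exists>vs. (\<forall>i\<le>2*(CARD('n)-2). vs i \<in> tangent_binding g p) \<and>
              alpha_omega_pow (CARD('n)-2) p vs \<noteq> 0))"

text \<open>Condition (2): d theta (R) > 0 on S_r - K_r.  For the unit-valued map theta, the
  derivative of the angle along R is Im(conj(theta) * D theta(R)).\<close>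
definition carry_cond2 :: "(complex^'n \<Rightarrow> complex) \<Rightarrow> real \<Rightarrow> bool" where
  "carry_cond2 g r \<longleftrightarrow>
     (\<forall>w \<in> sphere 0 r - binding g r. theta g differentiable (at w) \<and>
        Im (cnj (theta g w) * frechet_derivative (theta g) (at w) (reeb r w)) > 0)"

text \<open>Condition (3): orientations.  C^n carries its complex orientation (that of omega^n),
  S_r is oriented as boundary of the ball (outward normal p first), the fibres of theta are
  cooriented by d theta (a vector X with d theta(X) > 0 first), and at a binding point p the
  closure of the fibre through direction z has outward normal nu with Dg(nu) = -z, while
  X with Dg(X) = i z increases the angle.  Boundary orientation = outward normal first.
  Requirement: a tuple of tangent vectors of K_r is positive for alpha /\ (d alpha)^(n-2)
  iff it is positive as (part of) the boundary of the fibre.\<close>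
definition carry_cond3 :: "(complex^'n \<Rightarrow> complex) \<Rightarrow> real \<Rightarrow> bool" where
  "carry_cond3 g r \<longleftrightarrow>
     (\<forall>p \<in> binding g r. \<forall>vs z X \<nu>.
        (\<forall>i\<le>2*(CARD('n)-2). vs i \<in> tangent_binding g p) \<and> z \<noteq> 0 \<and>
        inner p X = 0 \<and> inner p \<nu> = 0 \<and>
        frechet_derivative g (at p) X = \<i> * z \<and> frechet_derivative g (at p) \<nu> = - z
        \<longrightarrow> sgn (alpha_omega_pow (CARD('n)-2) p vs) =
            sgn (omega_pow CARD('n)
                   (\<lambda>i. if i = 0 then p else if i = 1 then X else if i = 2 then \<nu>
                        else vs (i - 3))))"

definition contact_form_carried_by_milnor_open_book :: "(complex^'n \<Rightarrow> complex) \<Rightarrow> real \<Rightarrow> bool" where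
  "contact_form_carried_by_milnor_open_book g r \<longleftrightarrow>
     carry_cond1 g r \<and> carry_cond2 g r \<and> carry_cond3 g r"

end

theory Submission
  imports Defs
begin

text \<open>
  At a point \<open>p\<close> the derivative of \<open>g\<close> is \<open>L v = (\<Sum>j. A\<^sub>j v\<^sub>j + B\<^sub>j cnj v\<^sub>j)\<close> where
  \<open>|B\<^sub>j| = (b/a) |A\<^sub>j|\<close>. Non-degeneracy, applied to the face of the coordinate subspace spanned by
  the non-zero coordinates of \<open>p\<close>, shows that \<open>A \<noteq> 0\<close> at zeros of \<open>g\<close>, so \<open>|B| < |A|\<close>. The
  Poisson bracket of \<open>Re g\<close> and \<open>Im g\<close> is a multiple of \<open>|A|\<^sup>2 - |B|\<^sup>2 > 0\<close>; hence the kernel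
  of \<open>L\<close> is a symplectic subspace, and the two directions transverse to it are positively
  oriented. By the two Euler identities (radial and circular homogeneity of \<open>g\<close>) the kernel contains
  \<open>p\<close> and \<open>i p\<close> when \<open>g p = 0\<close>, which yields the contact condition and the orientations; the
  circular identity \<open>L (i w) = i (a - b) d g w\<close> gives positivity on the Reeb field.
\<close>

subsection \<open>The symplectic form\<close>

lemma linear_omega: "linear (omega u)"
  by (rule linearI)
     (simp_all add: omega_def algebra_simps sum.distrib sum_subtractf sum_distrib_left)

lemma omega_anticommute: "omega u v = - omega v u"
  by (simp add: omega_def sum_subtractf mult.commute)

lemma linear_omega_left: "linear (\<lambda>u. omega u v)"
  by (subst omega_anticommute) (intro linear_compose_neg linear_omega)

lemmas omega_add_right = linear_add[OF linear_omega]
  and omega_add_left = linear_add[OF linear_omega_left]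
  and omega_diff_right = linear_diff[OF linear_omega]
  and omega_scaleR_right = linear_cmul[OF linear_omega]
  and omega_scaleR_left = linear_cmul[OF linear_omega_left]

lemma omega_self [simp]: "omega u u = 0"
  using omega_anticommute[of u u] by simp

lemma alpha_eq_omega: "alpha p v = omega p v / 2"
  by (simp add: alpha_def omega_def)

lemma omega_times_ii:
  "omega u (\<chi> j. \<i> * u$j) = 4 * (norm u)\<^sup>2"
proof -
  have "Im (cnj (u$j) * (\<i> * u$j)) = (norm (u$j))\<^sup>2" for j
    unfolding cmod_power2 by (simp add: power2_eq_square)
  then show ?thesis
    by (simp add: omega_def norm_vec_def L2_set_def sum_nonneg)
qed

text \<open>Multiplication by i is compatible with the form and the metric. Tangency to the sphere
  at \<open>p\<close> thus becomes \<open>omega\<close>-orthogonality to the vector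
  \<open>i p\<close>.\<close>

lemma omega_times_ii_inner: "omega v (\<chi> j. \<i> * p$j) = 4 * inner p v"
  by (simp add: omega_def inner_vec_def inner_complex_def algebra_simps)

subsection \<open>Exterior powers of the symplectic form\<close>

text \<open>A positive multiple of the wedge of a linear form \<open>l\<close> with the k-th power
  of \<open>omega\<close>. Leaving \<open>l\<close> free lets it express the contraction of a power
  of \<open>omega\<close> with any vector, not only with \<open>p\<close>.\<close>

definition wedge_omega_pow :: "nat \<Rightarrow> (complex^'n \<Rightarrow> real) \<Rightarrow> (nat \<Rightarrow> complex^'n) \<Rightarrow> real" where
  "wedge_omega_pow k l vs =
     (\<Sum>\<sigma>\<in>{\<sigma>. \<sigma> permutes {..2*k}}. of_int (sign \<sigma>) * l (vs (\<sigma> 0)) *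
         (\<Prod>i<k. omega (vs (\<sigma> (2*i+1))) (vs (\<sigma> (2*i+2)))))"

text \<open>Shifts a permutation by one and fixes 0, so that alternating sums over permutations
  fixing the first slot reduce to sums over one index less.\<close>

definition lift_perm :: "(nat \<Rightarrow> nat) \<Rightarrow> nat \<Rightarrow> nat" where
  "lift_perm \<rho> = case_nat 0 (\<lambda>i. Suc (\<rho> i))"

lemma lift_perm_simps [simp]:
  "lift_perm \<rho> 0 = 0" "lift_perm \<rho> (Suc i) = Suc (\<rho> i)"
  by (simp_all add: lift_perm_def)

lemma lift_perm_eq_map_permutation:
  assumes "\<rho> permutes {..<m}"
  shows "lift_perm \<rho> = map_permutation {..<m} Suc \<rho>"
proof
  fix i
  show "lift_perm \<rho> i = map_permutation {..<m} Suc \<rho> i"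
  proof (cases i)
    case 0
    then show ?thesis by (simp add: map_permutation_def restrict_id_def)
  next
    case (Suc j)
    show ?thesis
    proof (cases "j < m")
      case True
      then show ?thesis using Suc by (simp add: map_permutation_apply)
    next
      case False
      then show ?thesis using Suc permutes_not_in[OF assms, of j]
        by (auto simp add: map_permutation_def restrict_id_def)
    qed
  qed
qed

lemma sign_lift_perm:
  assumes "\<rho> permutes {..<m}"
  shows "sign (lift_perm \<rho>) = sign \<rho>"
  using assms by (simp add: lift_perm_eq_map_permutation sign_map_permutation)

lemma bij_betw_lift_perm:
  "bij_betw lift_perm {\<rho>. \<rho> permutes {..<m}} {\<sigma>. \<sigma> permutes {..<Suc m} \<and> \<sigma> 0 = 0}"
proof -
  have bij: "bij_betw Suc {..<m} {1..<Suc m}"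
    by (simp add: bij_betw_def image_Suc_lessThan atLeastLessThanSuc_atLeastAtMost)
  have "bij_betw (map_permutation {..<m} Suc)
          {\<rho>. \<rho> permutes {..<m}} {\<sigma>. \<sigma> permutes {1..<Suc m}}"
    using bij_betw_permutations[OF bij] bij
    by (simp add: map_permutation_def[abs_def] restrict_id_def comp_def bij_betw_def cong: if_cong)
  moreover have "{\<sigma>. \<sigma> permutes {1..<Suc m}} = {\<sigma>. \<sigma> permutes {..<Suc m} \<and> \<sigma> 0 = 0}"
  proof (intro set_eqI iffI)
    fix \<sigma> assume s: "\<sigma> \<in> {\<sigma>. \<sigma> permutes {1..<Suc m}}"
    then have "\<sigma> permutes {..<Suc m}" by (auto intro: permutes_subset)
    moreover have "\<sigma> 0 = 0" using s by (auto intro: permutes_not_in)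
    ultimately show "\<sigma> \<in> {\<sigma>. \<sigma> permutes {..<Suc m} \<and> \<sigma> 0 = 0}" by simp
  next
    fix \<sigma> assume "\<sigma> \<in> {\<sigma>. \<sigma> permutes {..<Suc m} \<and> \<sigma> 0 = 0}"
    then have "\<sigma> permutes {..<Suc m}" "\<sigma> 0 = 0" by auto
    then have "\<sigma> permutes {1..<Suc m}"
      by (rule_tac permutes_superset) (auto simp: not_less_eq_eq)
    then show "\<sigma> \<in> {\<sigma>. \<sigma> permutes {1..<Suc m}}" by simp
  qed
  ultimately have "bij_betw (map_permutation {..<m} Suc)
      {\<rho>. \<rho> permutes {..<m}} {\<sigma>. \<sigma> permutes {..<Suc m} \<and> \<sigma> 0 = 0}"
    by simp
  then show ?thesis
    by (rule bij_betw_cong[THEN iffD1, rotated]) (simp add: lift_perm_eq_map_permutation)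
qed

lemma sum_perms_fixing_0:
  "(\<Sum>\<sigma>\<in>{\<sigma>. \<sigma> permutes {..<Suc m}}. if \<sigma> 0 = 0 then F \<sigma> else (0::real)) =
   (\<Sum>\<rho>\<in>{\<rho>. \<rho> permutes {..<m}}. F (lift_perm \<rho>))"
proof -
  have "(\<Sum>\<sigma>\<in>{\<sigma>. \<sigma> permutes {..<Suc m}}. if \<sigma> 0 = 0 then F \<sigma> else 0) =
        (\<Sum>\<sigma>\<in>{\<sigma>. \<sigma> permutes {..<Suc m} \<and> \<sigma> 0 = 0}. F \<sigma>)"
    by (rule sum.mono_neutral_cong_right) (auto intro: finite_permutations)
  also have "\<dots> = (\<Sum>\<rho>\<in>{\<rho>. \<rho> permutes {..<m}}. F (lift_perm \<rho>))"
    by (rule sum.reindex_bij_betw[OF bij_betw_lift_perm, symmetric])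
  finally show ?thesis .
qed

lemma omega_pow_permute:
  assumes "\<tau> permutes {..<2*k}"
  shows "omega_pow k (vs \<circ> \<tau>) = of_int (sign \<tau>) * omega_pow k vs"
proof -
  let ?P = "{\<sigma>. \<sigma> permutes {..<2*k}}"
  let ?F = "\<lambda>\<sigma>. of_int (sign \<sigma>) * (\<Prod>i<k. omega (vs (\<sigma> (2*i))) (vs (\<sigma> (2*i+1)))) :: real"
  have "sum ?F ?P = (\<Sum>\<sigma>\<in>?P. ?F (\<tau> \<circ> \<sigma>))"
    by (rule setum_permutations_compose_left[OF assms])
  also have "\<dots> = (\<Sum>\<sigma>\<in>?P. of_int (sign \<tau>) * (of_int (sign \<sigma>) * 
      (\<Prod>i<k. omega ((vs \<circ> \<tau>) (\<sigma> (2*i))) ((vs \<circ> \<tau>) (\<sigma> (2*i+1))))))"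
  proof (intro sum.cong refl)
    fix \<sigma> assume "\<sigma> \<in> ?P"
    then have "sign (\<tau> \<circ> \<sigma>) = sign \<tau> * sign \<sigma>"
      using assms by (auto intro!: sign_compose permutes_imp_permutation[OF finite_lessThan])
    then show "?F (\<tau> \<circ> \<sigma>) = of_int (sign \<tau>) * (of_int (sign \<sigma>) *
        (\<Prod>i<k. omega ((vs \<circ> \<tau>) (\<sigma> (2*i))) ((vs \<circ> \<tau>) (\<sigma> (2*i+1)))))"
      by simp
  qed
  finally have "omega_pow k vs = of_int (sign \<tau>) * omega_pow k (vs \<circ> \<tau>)"
    by (simp add: omega_pow_def sum_distrib_left)
  then have "of_int (sign \<tau>) * omega_pow k vs
      = of_int (sign \<tau> * sign \<tau>) * omega_pow k (vs \<circ> \<tau>)"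
    unfolding of_int_mult by simp
  then show ?thesis by simp
qed

text \<open>The transposition of the two slots fixes the tuple but changes the sign of the
  value.\<close>

lemma omega_pow_repeated:
  assumes "i < 2*k" "j < 2*k" "i \<noteq> j" "vs i = vs j"
  shows "omega_pow k vs = 0"
proof -
  have "vs \<circ> Transposition.transpose i j = vs"
    using assms(4) by (auto simp: fun_eq_iff Transposition.transpose_def)
  then have "omega_pow k vs = - omega_pow k vs"
    using omega_pow_permute[of "Transposition.transpose i j" k vs] assms
    by (simp add: permutes_swap_id sign_swap_id)
  then show ?thesis by simp
qed

text \<open>Every position of the first vector in the alternating sum contributes equally: exchange its
  factor with the first one, and the two slots of that factor if necessary.\<close>

lemma omega_pow_Suc:
  "omega_pow (Suc k) vs = 2 * real (Suc k) * wedge_omega_pow k (omega (vs 0)) (vs \<circ> Suc)"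
proof -
  let ?A = "{..<2 * Suc k}"
  let ?P = "{\<sigma>. \<sigma> permutes ?A}"
  define F where "F \<sigma> = of_int (sign \<sigma>) *
     (\<Prod>i<Suc k. omega (vs (\<sigma> (2*i))) (vs (\<sigma> (2*i+1))))" for \<sigma> :: "nat \<Rightarrow> nat"
  \<comment> \<open>The sign of the transposition cancels against the antisymmetry of
    \<open>omega\<close> in the first factor.\<close>
  have swap01: "F (\<sigma> \<circ> Transposition.transpose 0 1) = F \<sigma>" if "\<sigma> permutes ?A" for \<sigma>
  proof -
    have "(\<Prod>i<Suc k. omega (vs ((\<sigma> \<circ> Transposition.transpose 0 1) (2*i))) (vs ((\<sigma> \<circ> Transposition.transpose 0 1) (2*i+1))))
        = omega (vs (\<sigma> 1)) (vs (\<sigma> 0)) * (\<Prod>i<k. omega (vs (\<sigma> (2*Suc i))) (vs (\<sigma> (2*Suc i+1))))"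
      unfolding prod.lessThan_Suc_shift by (simp add: Transposition.transpose_def)
    also have "\<dots> = - (\<Prod>i<Suc k. omega (vs (\<sigma> (2*i))) (vs (\<sigma> (2*i+1))))"
      unfolding prod.lessThan_Suc_shift by (simp add: omega_anticommute[of "vs (\<sigma> (Suc 0))"])
    moreover have "sign (\<sigma> \<circ> Transposition.transpose 0 1) = - sign \<sigma>"
      using permutes_imp_permutation[OF _ that]
      by (simp add: sign_compose permutation_swap_id sign_swap_id)
    ultimately show ?thesis by (simp add: F_def)
  qed
  \<comment> \<open>Exchanges block (0, 1) with block (2m, 2m+1). It is an even permutation (the
    identity for m = 0) and only reorders the factors of the product.\<close>
  define pairswap where
    "pairswap m = Transposition.transpose 0 (2*m) \<circ> Transposition.transpose 1 (2*m+1)" for m :: nat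
  have pairswap_perm: "pairswap m permutes ?A" if "m < Suc k" for m
    unfolding pairswap_def using that by (intro permutes_compose permutes_swap_id) auto
  have pairswap_even: "pairswap m (2*i) = 2 * Transposition.transpose 0 m i" for m i
    unfolding pairswap_def by (auto simp: Transposition.transpose_def) presburger
  have pairswap_odd: "pairswap m (2*i+1) = 2 * Transposition.transpose 0 m i + 1" for m i
    unfolding pairswap_def by (auto simp: Transposition.transpose_def)
  have pair: "F (\<sigma> \<circ> pairswap m) = F \<sigma>" if s: "\<sigma> permutes ?A" and m: "m < Suc k" for \<sigma> m
  proof -
    have "sign (pairswap m) = 1"
      unfolding pairswap_def by (simp add: sign_compose permutation_swap_id sign_swap_id)
    then have "sign (\<sigma> \<circ> pairswap m) = sign \<sigma>"
      using permutes_imp_permutation[OF _ s] permutes_imp_permutation[OF _ pairswap_perm[OF m]]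
      by (simp add: sign_compose)
    moreover have "(\<Prod>i<Suc k. omega (vs ((\<sigma> \<circ> pairswap m) (2*i))) (vs ((\<sigma> \<circ> pairswap m) (2*i+1))))
        = (\<Prod>i<Suc k. (\<lambda>i. omega (vs (\<sigma> (2*i))) (vs (\<sigma> (2*i+1)))) (Transposition.transpose 0 m i))"
      unfolding comp_apply pairswap_even pairswap_odd ..
    moreover have "\<dots> = (\<Prod>i<Suc k. omega (vs (\<sigma> (2*i))) (vs (\<sigma> (2*i+1))))"
      by (rule prod.reindex_bij_betw) (use m in \<open>auto intro!: permutes_imp_bij permutes_swap_id\<close>)
    ultimately show ?thesis by (simp add: F_def)
  qed
  have pos: "(\<Sum>\<sigma>\<in>?P. if \<sigma> m = 0 then F \<sigma> else 0) = (\<Sum>\<sigma>\<in>?P. if \<sigma> 0 = 0 then F \<sigma> else 0)"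
    if "m \<in> ?A" for m
  proof -
    define q where "q = m div 2"
    have q: "q < Suc k" using that by (auto simp: q_def)
    have even: "(\<Sum>\<sigma>\<in>?P. if \<sigma> (2*q) = 0 then F \<sigma> else 0) = (\<Sum>\<sigma>\<in>?P. if \<sigma> 0 = 0 then F \<sigma> else 0)"
    proof -
      have "(\<Sum>\<sigma>\<in>?P. if \<sigma> (2*q) = 0 then F \<sigma> else 0)
          = (\<Sum>\<sigma>\<in>?P. if (\<sigma> \<circ> pairswap q) (2*q) = 0 then F (\<sigma> \<circ> pairswap q) else 0)"
        by (rule sum_permutations_compose_right[OF pairswap_perm[OF q]])
      also have "\<dots> = (\<Sum>\<sigma>\<in>?P. if \<sigma> 0 = 0 then F \<sigma> else 0)"
        using pair q pairswap_even[of q q] by (intro sum.cong) auto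
      finally show ?thesis .
    qed
    show ?thesis
    proof (cases "even m")
      case True
      then show ?thesis using even by (simp add: q_def)
    next
      case False
      then have m: "m = 2*q+1" by (simp add: q_def)
      have t: "Transposition.transpose 0 1 permutes ?A" by (rule permutes_swap_id) auto
      have "(\<Sum>\<sigma>\<in>?P. if \<sigma> m = 0 then F \<sigma> else 0)
          = (\<Sum>\<sigma>\<in>?P. if (\<sigma> \<circ> pairswap q) m = 0 then F (\<sigma> \<circ> pairswap q) else 0)"
        by (rule sum_permutations_compose_right[OF pairswap_perm[OF q]])
      also have "\<dots> = (\<Sum>\<sigma>\<in>?P. if \<sigma> 1 = 0 then F \<sigma> else 0)"
        using pair q pairswap_odd[of q q] m by (intro sum.cong) auto
      also have "\<dots> = (\<Sum>\<sigma>\<in>?P. if (\<sigma> \<circ> Transposition.transpose 0 1) 1 = 0 then F (\<sigma> \<circ> Transposition.transpose 0 1) else 0)"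
        by (rule sum_permutations_compose_right[OF t])
      also have "\<dots> = (\<Sum>\<sigma>\<in>?P. if \<sigma> 0 = 0 then F \<sigma> else 0)"
        using swap01 by (intro sum.cong) auto
      finally show ?thesis .
    qed
  qed
  have "omega_pow (Suc k) vs = (\<Sum>\<sigma>\<in>?P. F \<sigma>)"
    by (simp only: omega_pow_def F_def)
  \<comment> \<open>Each permutation sends exactly one position \<open>m\<close> to 0; the sum is
    split according to it.\<close>
  also have "\<dots> = (\<Sum>\<sigma>\<in>?P. \<Sum>m\<in>?A. if \<sigma> m = 0 then F \<sigma> else 0)"
  proof (intro sum.cong refl)
    fix \<sigma> assume "\<sigma> \<in> ?P"
    then have s: "\<sigma> permutes ?A" by simp
    have "\<sigma> m = 0 \<longleftrightarrow> inv \<sigma> 0 = m" for m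
      using permutes_inv_eq[OF s] by auto
    moreover have "inv \<sigma> 0 \<in> ?A"
      using permutes_in_image[OF permutes_inv[OF s], of 0] by simp
    ultimately show "F \<sigma> = (\<Sum>m\<in>?A. if \<sigma> m = 0 then F \<sigma> else 0)" by simp
  qed
  also have "\<dots> = (\<Sum>m\<in>?A. \<Sum>\<sigma>\<in>?P. if \<sigma> m = 0 then F \<sigma> else 0)"
    by (rule sum.swap)
  also have "\<dots> = (\<Sum>m\<in>?A. \<Sum>\<sigma>\<in>?P. if \<sigma> 0 = 0 then F \<sigma> else 0)"
    using pos by (rule sum.cong[OF refl])
  also have "\<dots> = 2 * real (Suc k) * (\<Sum>\<sigma>\<in>?P. if \<sigma> 0 = 0 then F \<sigma> else 0)"
    by simp
  also have "(\<Sum>\<sigma>\<in>?P. if \<sigma> 0 = 0 then F \<sigma> else 0)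
      = (\<Sum>\<rho>\<in>{\<rho>. \<rho> permutes {..<Suc (2*k)}}. F (lift_perm \<rho>))"
    using sum_perms_fixing_0[where m = "Suc (2*k)" and F = F] by simp
  also have "\<dots> = wedge_omega_pow k (omega (vs 0)) (vs \<circ> Suc)"
    unfolding wedge_omega_pow_def lessThan_Suc_atMost
  proof (intro sum.cong refl)
    fix \<rho> assume "\<rho> \<in> {\<rho>. \<rho> permutes {..2*k}}"
    then have "sign (lift_perm \<rho>) = sign \<rho>"
      using sign_lift_perm[of \<rho> "Suc (2*k)"] by (simp add: lessThan_Suc_atMost)
    then show "F (lift_perm \<rho>) = of_int (sign \<rho>) * omega (vs 0) ((vs \<circ> Suc) (\<rho> 0)) *
        (\<Prod>i<k. omega ((vs \<circ> Suc) (\<rho> (2*i+1))) ((vs \<circ> Suc) (\<rho> (2*i+2))))"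
      unfolding F_def prod.lessThan_Suc_shift
      by (simp add: numeral_eq_Suc)
  qed
  finally show ?thesis .
qed

text \<open>Since \<open>l\<close> kills every vector but the first, only permutations fixing 0
  contribute, and these are the lifts.\<close>

lemma wedge_omega_pow_eq:
  assumes "\<And>i. i < 2*k \<Longrightarrow> l (vs (Suc i)) = 0"
  shows "wedge_omega_pow k l vs = l (vs 0) * omega_pow k (vs \<circ> Suc)"
proof -
  define F where "F \<sigma> = of_int (sign \<sigma>) * l (vs (\<sigma> 0)) *
    (\<Prod>i<k. omega (vs (\<sigma> (2*i+1))) (vs (\<sigma> (2*i+2))))" for \<sigma> :: "nat \<Rightarrow> nat"
  have "wedge_omega_pow k l vs = (\<Sum>\<sigma>\<in>{\<sigma>. \<sigma> permutes {..<Suc (2*k)}}. F \<sigma>)"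
    by (simp add: wedge_omega_pow_def F_def lessThan_Suc_atMost)
  also have "\<dots> = (\<Sum>\<sigma>\<in>{\<sigma>. \<sigma> permutes {..<Suc (2*k)}}. if \<sigma> 0 = 0 then F \<sigma> else 0)"
  proof (intro sum.cong refl)
    fix \<sigma> assume "\<sigma> \<in> {\<sigma>. \<sigma> permutes {..<Suc (2*k)}}"
    then have "\<sigma> 0 < Suc (2*k)" using permutes_in_image[of \<sigma> "{..<Suc (2*k)}" 0] by simp
    then have "l (vs (\<sigma> 0)) = 0" if "\<sigma> 0 \<noteq> 0"
      using assms[of "\<sigma> 0 - 1"] that by simp
    then show "F \<sigma> = (if \<sigma> 0 = 0 then F \<sigma> else 0)" by (simp add: F_def)
  qed
  also have "\<dots> = (\<Sum>\<rho>\<in>{\<rho>. \<rho> permutes {..<2*k}}. F (lift_perm \<rho>))"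
    by (rule sum_perms_fixing_0)
  also have "\<dots> = (\<Sum>\<rho>\<in>{\<rho>. \<rho> permutes {..<2*k}}. l (vs 0) * (of_int (sign \<rho>) *
     (\<Prod>i<k. omega ((vs \<circ> Suc) (\<rho> (2*i))) ((vs \<circ> Suc) (\<rho> (2*i+1))))))"
    by (rule sum.cong) (auto simp: F_def sign_lift_perm)
  finally show ?thesis by (simp add: omega_pow_def sum_distrib_left)
qed

text \<open>Contracting with \<open>x\<close> leaves the form \<open>omega x\<close>, which vanishes
  on all remaining vectors except \<open>y\<close>. No orthogonality between \<open>y\<close> and
  \<open>vs\<close> enters.\<close>

lemma omega_pow_Suc_orthogonal:
  assumes "\<And>i. i < 2*k \<Longrightarrow> omega x (vs i) = 0"
  shows "omega_pow (Suc k) (case_nat x (case_nat y vs)) = 2 * real (Suc k) * omega x y * omega_pow k vs"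
  using assms by (simp add: omega_pow_Suc wedge_omega_pow_eq comp_def)

lemma omega_pow_Suc_orthogonal_all:
  assumes "\<And>i. i \<le> 2*k \<Longrightarrow> omega x (vs i) = 0"
  shows "omega_pow (Suc k) (case_nat x vs) = 0"
  using assms by (simp add: omega_pow_Suc wedge_omega_pow_eq comp_def)

text \<open>Because \<open>alpha p\<close> is half of \<open>omega p\<close>, the contact volume is
  a positive multiple of a power of \<open>omega\<close> contracted with the radial vector. Both
  sides of the orientation condition thereby become values of \<open>omega_pow\<close>.\<close>

lemma alpha_omega_pow_eq:
  "alpha_omega_pow k p vs = omega_pow (Suc k) (case_nat p vs) / (4 * real (Suc k))"
proof -
  have "alpha_omega_pow k p vs = wedge_omega_pow k (omega p) vs / 2"
    by (simp add: alpha_omega_pow_def wedge_omega_pow_def alpha_eq_omega sum_divide_distrib)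
  then show ?thesis by (simp add: omega_pow_Suc comp_def del: of_nat_Suc)
qed

lemma linear_omega_pow_first: "linear (\<lambda>x. omega_pow (Suc k) (case_nat x vs))"
proof -
  have "linear (\<lambda>x. wedge_omega_pow k (omega x) vs)"
    by (rule linearI)
      (simp_all add: wedge_omega_pow_def omega_add_left omega_scaleR_left algebra_simps
        sum.distrib sum_distrib_left)
  from linear_compose_scale_right[OF this, of "2 * real (Suc k)"] show ?thesis
    by (simp add: omega_pow_Suc comp_def del: of_nat_Suc)
qed

lemma omega_pow_swap01:
  "omega_pow (Suc k) (case_nat x (case_nat y vs)) = - omega_pow (Suc k) (case_nat y (case_nat x vs))"
proof -
  have "case_nat x (case_nat y vs) = case_nat y (case_nat x vs) \<circ> Transposition.transpose 0 1"
    by (auto simp: fun_eq_iff Transposition.transpose_def split: nat.split)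
  then show ?thesis
    by (simp add: omega_pow_permute permutes_swap_id sign_swap_id)
qed

lemma omega_pow_swap12:
  assumes "k > 0"
  shows "omega_pow (Suc k) (case_nat x (case_nat y (case_nat z vs)))
    = - omega_pow (Suc k) (case_nat x (case_nat z (case_nat y vs)))"
proof -
  have "case_nat x (case_nat y (case_nat z vs)) = case_nat x (case_nat z (case_nat y vs)) \<circ> Transposition.transpose 1 2"
    by (auto simp: fun_eq_iff Transposition.transpose_def numeral_2_eq_2 split: nat.split)
  then show ?thesis
    using assms by (simp add: omega_pow_permute permutes_swap_id sign_swap_id)
qed

text \<open>More than 2n distinct vectors are dependent. One that lies in the span of the others is
  moved to the first slot, where linearity reduces to tuples with a repetition. Tuples that already
  repeat a vector are split off first, because their set of values may be independent.\<close>

lemma omega_pow_above_dim: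
  fixes vs :: "nat \<Rightarrow> complex^'n"
  assumes "k > CARD('n)"
  shows "omega_pow k vs = 0"
proof (cases "inj_on vs {..<2*k}")
  case False
  then show ?thesis by (auto simp: inj_on_def intro: omega_pow_repeated)
next
  case True
  obtain m where k: "k = Suc m" using assms by (cases k) auto
  have "DIM(complex^'n) < card (vs ` {..<2*k})"
    using assms by (simp add: card_image[OF True])
  then have "dependent (vs ` {..<2*k})"
    by (auto intro: dependent_biggerset)
  then obtain i where i: "i < 2*k" and "vs i \<in> span (vs ` {..<2*k} - {vs i})"
    unfolding dependent_def by auto
  moreover have "vs ` {..<2*k} - {vs i} = vs ` ({..<2*k} - {i})"
    using True i by (auto simp: inj_on_def)
  ultimately have span: "vs i \<in> span (vs ` ({..<2*k} - {i}))" by simp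
  define us where "us = vs \<circ> Transposition.transpose 0 i"
  have "omega_pow k (case_nat x (us \<circ> Suc)) = 0" if x: "x \<in> vs ` ({..<2*k} - {i})" for x
  proof -
    obtain j where j: "j < 2*k" "j \<noteq> i" "x = vs j" using x by auto
    define q where "q = Transposition.transpose 0 i j"
    have q: "0 < q" "q < 2*k" and "us q = x"
      using j i by (auto simp: q_def us_def Transposition.transpose_def)
    then have "case_nat x (us \<circ> Suc) 0 = case_nat x (us \<circ> Suc) q"
      by (auto split: nat.split)
    with q show ?thesis by (intro omega_pow_repeated[of 0 _ q]) auto
  qed
  then have "omega_pow k (case_nat (vs i) (us \<circ> Suc)) = 0"
    using linear_eq_0_on_span[OF linear_omega_pow_first _ span, of m "us \<circ> Suc"] k by simp
  moreover have "case_nat (vs i) (us \<circ> Suc) = us"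
    by (auto simp: fun_eq_iff us_def split: nat.split)
  ultimately have "omega_pow k us = 0" by simp
  then show ?thesis
    using omega_pow_permute[of "Transposition.transpose 0 i" k vs] i
    by (simp add: us_def permutes_swap_id)
qed

subsection \<open>Symplectic subspaces\<close>

definition symplectic_subspace :: "(complex^'n) set \<Rightarrow> bool" where
  "symplectic_subspace S \<longleftrightarrow> subspace S \<and> (\<forall>u\<in>S. (\<forall>v\<in>S. omega u v = 0) \<longrightarrow> u = 0)"

text \<open>The plane of \<open>p\<close> and \<open>q\<close> is non-degenerate, so
  \<open>S\<close> splits as this plane plus its \<open>omega\<close>-orthogonal complement in
  \<open>S\<close>.\<close>

lemma symplectic_subspace_complement:
  assumes S: "symplectic_subspace S" and pq: "p \<in> S" "q \<in> S" "omega p q \<noteq> 0"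
  defines "S' \<equiv> {u\<in>S. omega p u = 0 \<and> omega q u = 0}"
  shows "symplectic_subspace S'" and "dim S \<le> dim S' + 2"
proof -
  have sub: "subspace S" using S by (simp add: symplectic_subspace_def)
  have sub': "subspace S'"
    unfolding S'_def subspace_def
    using sub by (auto simp: subspace_0 subspace_add subspace_scale linear_0[OF linear_omega]
      omega_add_right omega_scaleR_right)
  have dec: "\<exists>s y z. u = s + y *\<^sub>R p + z *\<^sub>R q \<and> s \<in> S'" if "u \<in> S" for u
  proof -
    \<comment> \<open>The coefficients solve \<open>omega q s = 0\<close> and
      \<open>omega p s = 0\<close> respectively.\<close>
    define y z where "y = omega u q / omega p q" and "z = - omega u p / omega p q"
    define s where "s = u - y *\<^sub>R p - z *\<^sub>R q"
    have "s \<in> S" using that pq sub by (simp add: s_def subspace_diff subspace_scale)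
    moreover have "omega p s = 0" "omega q s = 0"
      using pq(3) omega_anticommute[of q p] omega_anticommute[of u p] omega_anticommute[of u q]
      by (simp_all add: s_def omega_diff_right omega_add_right omega_scaleR_right y_def z_def)
    ultimately show ?thesis
      by (intro exI[of _ s] exI[of _ y] exI[of _ z]) (simp add: S'_def s_def)
  qed
  show "symplectic_subspace S'"
    unfolding symplectic_subspace_def
  proof (intro conjI sub' ballI impI)
    fix u assume u: "u \<in> S'" and orth: "\<forall>v\<in>S'. omega u v = 0"
    have "omega u v = 0" if v: "v \<in> S" for v
    proof -
      obtain s y z where veq: "v = s + y *\<^sub>R p + z *\<^sub>R q" and s: "s \<in> S'" using dec[OF v] by blast
      have "omega u p = 0" "omega u q = 0"
        using u omega_anticommute[of u p] omega_anticommute[of u q] by (simp_all add: S'_def)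
      then show ?thesis
        using orth s by (simp add: veq omega_add_right omega_scaleR_right)
    qed
    then show "u = 0" using S u by (auto simp: symplectic_subspace_def S'_def)
  qed
  have "S \<subseteq> span (insert p (insert q S'))"
  proof
    fix u assume "u \<in> S"
    then obtain s y z where "u = s + y *\<^sub>R p + z *\<^sub>R q" "s \<in> S'" using dec by blast
    then show "u \<in> span (insert p (insert q S'))"
      by (auto intro!: span_add span_scale intro: span_base)
  qed
  then have "dim S \<le> dim (insert p (insert q S'))" by (rule subset_le_dim)
  also have "\<dots> \<le> dim S' + 2" by (simp add: dim_insert)
  finally show "dim S \<le> dim S' + 2" .
qed

text \<open>Symplectic Gram-Schmidt: a pair with \<open>omega p q\<close> non-zero is split off, and
  the complement supplies the other vectors by induction.\<close>

lemma symplectic_subspace_omega_pow: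
  assumes "symplectic_subspace S" "dim S \<ge> 2*k"
  shows "\<exists>vs. (\<forall>i. vs i \<in> S) \<and> omega_pow k vs \<noteq> 0"
  using assms
proof (induction k arbitrary: S)
  case 0
  then have "0 \<in> S" by (simp add: symplectic_subspace_def subspace_0)
  then show ?case by (intro exI[of _ "\<lambda>_. 0"]) (simp add: omega_pow_def)
next
  case (Suc k)
  then have "\<not> S \<subseteq> {0}" by (metis dim_eq_0 Suc_le_D mult_Suc_right add_Suc numeral_2_eq_2 nat.distinct(1))
  then obtain p where p: "p \<in> S" "p \<noteq> 0" by auto
  then obtain q where q: "q \<in> S" "omega p q \<noteq> 0"
    using Suc.prems(1) by (auto simp: symplectic_subspace_def)
  define S' where "S' = {u\<in>S. omega p u = 0 \<and> omega q u = 0}"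
  have S': "symplectic_subspace S'" "dim S \<le> dim S' + 2"
    unfolding S'_def using symplectic_subspace_complement[OF Suc.prems(1) p(1) q] by auto
  then obtain vs where vs: "\<forall>i. vs i \<in> S'" "omega_pow k vs \<noteq> 0"
    using Suc.IH[of S'] Suc.prems(2) by auto
  have "omega_pow (Suc k) (case_nat p (case_nat q vs)) \<noteq> 0"
    using vs q(2) by (subst omega_pow_Suc_orthogonal) (auto simp: S'_def)
  moreover have "case_nat p (case_nat q vs) i \<in> S" for i
    using p q vs by (auto simp: S'_def split: nat.split)
  ultimately show ?case by blast
qed

section \<open>Real linear forms with dominant complex-linear part, and their kernels\<close>

definition real_linear_form :: "complex^'n \<Rightarrow> complex^'n \<Rightarrow> complex^'n \<Rightarrow> complex" where
  "real_linear_form A B v = (\<Sum>j\<in>UNIV. A$j * v$j + B$j * cnj (v$j))"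

lemma linear_real_linear_form: "linear (real_linear_form A B)"
  by (rule linearI)
     (simp_all add: real_linear_form_def algebra_simps sum.distrib scaleR_sum_right)

locale antilinear_dominated =
  fixes A B :: "complex^'n"
  assumes pos: "norm B < norm A"
begin

abbreviation L :: "complex^'n \<Rightarrow> complex" where
  "L \<equiv> real_linear_form A B"

text \<open>A positive multiple of the Poisson bracket of the real and imaginary parts of
  \<open>L\<close>: with \<open>H\<close> as below, \<open>omega (H 1) (H \<i>)\<close> equals
  \<open>4 * \<Delta>\<close>.\<close>

definition \<Delta> :: real where
  "\<Delta> = (norm A)\<^sup>2 - (norm B)\<^sup>2"

text \<open>The Hamiltonian vectors of the real linear functions \<open>4 Re (cnj \<zeta> * L u)\<close>; they
  span the symplectic complement of the kernel of \<open>L\<close>.\<close>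

definition H :: "complex \<Rightarrow> complex^'n" where
  "H \<zeta> = (\<chi> j. - \<i> * (\<zeta> * cnj (A$j) + cnj \<zeta> * B$j))"

definition W :: "(complex^'n) set" where
  "W = {v. L v = 0}"

lemma \<Delta>_pos: "\<Delta> > 0"
  using pos by (simp add: \<Delta>_def power_strict_mono)

lemma omega_H: "omega (H \<zeta>) u = 4 * Re (cnj \<zeta> * L u)"
proof -
  have "Im (cnj (H \<zeta> $ j) * u $ j) = Re (cnj \<zeta> * (A$j * u$j + B$j * cnj (u$j)))" for j
    by (simp add: H_def algebra_simps)
  then show ?thesis unfolding omega_def real_linear_form_def by (simp only: sum_distrib_left Re_sum)
qed

text \<open>The mixed products of \<open>A$j\<close> and \<open>B$j\<close> cancel. As
  \<open>\<Delta>\<close> is non-zero, \<open>L\<close> is bijective on the plane of Hamiltonian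
  vectors, which is therefore a complement of \<open>W\<close>.\<close>

lemma L_H: "L (H \<eta>) = - \<i> * of_real \<Delta> * \<eta>"
proof -
  have "A$j * H \<eta> $ j + B$j * cnj (H \<eta> $ j) =
      - \<i> * \<eta> * of_real ((cmod (A$j))\<^sup>2 - (cmod (B$j))\<^sup>2)" for j
    by (simp add: H_def complex_norm_square algebra_simps flip: of_real_power)
  moreover have "\<Delta> = (\<Sum>j\<in>UNIV. (cmod (A$j))\<^sup>2 - (cmod (B$j))\<^sup>2)"
    by (simp add: \<Delta>_def norm_vec_def L2_set_def sum_nonneg sum_subtractf)
  ultimately have "L (H \<eta>) = (\<Sum>j\<in>UNIV. - \<i> * \<eta> * of_real ((cmod (A$j))\<^sup>2 - (cmod (B$j))\<^sup>2))"
    and "\<Delta> = (\<Sum>j\<in>UNIV. (cmod (A$j))\<^sup>2 - (cmod (B$j))\<^sup>2)"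
    by (simp_all only: real_linear_form_def)
  then show ?thesis by (simp only: flip: sum_distrib_left of_real_sum) simp
qed

lemma L_surj: "L (H (\<i> * z / of_real \<Delta>)) = z"
  using \<Delta>_pos by (simp add: L_H)

lemma W_decomp: "\<exists>\<zeta> w. u = H \<zeta> + w \<and> w \<in> W"
proof -
  have "u - H (\<i> * L u / of_real \<Delta>) \<in> W"
    by (simp add: W_def linear_diff[OF linear_real_linear_form] L_surj)
  then show ?thesis by (metis add.commute diff_add_cancel)
qed

lemma omega_H_W: "w \<in> W \<Longrightarrow> omega (H \<zeta>) w = 0"
  by (simp add: omega_H W_def)

lemma symplectic_W: "symplectic_subspace W"
  unfolding symplectic_subspace_def
proof (intro conjI ballI impI)
  show "subspace W"
    unfolding W_def by (rule linear_subspace_kernel[OF linear_real_linear_form])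
  fix u assume u: "u \<in> W" and orth: "\<forall>v\<in>W. omega u v = 0"
  \<comment> \<open>A vector of \<open>W\<close> orthogonal to \<open>W\<close> is also orthogonal
    to all \<open>H \<zeta>\<close>, hence to every vector; testing it against i times itself gives
    its norm.\<close>
  obtain \<zeta> w where dec: "(\<chi> j. \<i> * u$j) = H \<zeta> + w" "w \<in> W" using W_decomp by blast
  have "omega u (\<chi> j. \<i> * u$j) = 0"
    using orth dec(2) omega_H_W[OF u] omega_anticommute[of u "H \<zeta>"]
    by (simp add: dec(1) omega_add_right)
  then show "u = 0" by (simp add: omega_times_ii)
qed

lemma dim_W: "dim W + 2 \<ge> 2 * CARD('n)"
proof -
  have H: "H \<zeta> = Re \<zeta> *\<^sub>R H 1 + Im \<zeta> *\<^sub>R H \<i>" for \<zeta>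
    by (simp add: vec_eq_iff H_def complex_eq_iff algebra_simps)
  have "UNIV \<subseteq> span (insert (H 1) (insert (H \<i>) W))"
  proof
    fix u
    obtain \<zeta> w where "u = H \<zeta> + w" "w \<in> W" using W_decomp by blast
    then have "u = Re \<zeta> *\<^sub>R H 1 + Im \<zeta> *\<^sub>R H \<i> + w" by (simp flip: H)
    with \<open>w \<in> W\<close> show "u \<in> span (insert (H 1) (insert (H \<i>) W))"
      by (auto intro!: span_add span_scale intro: span_base)
  qed
  then have "dim (UNIV :: (complex^'n) set) \<le> dim (insert (H 1) (insert (H \<i>) W))"
    by (rule subset_le_dim)
  also have "\<dots> \<le> dim W + 2" by (simp add: dim_insert)
  finally show ?thesis by simp
qed

text \<open>Adding two Hamiltonian vectors to the tuple would give a non-zero value of a form of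
  degree larger than the real dimension.\<close>

lemma omega_pow_W:
  assumes "k \<ge> CARD('n)" "\<And>i. i < 2*k \<Longrightarrow> vs i \<in> W"
  shows "omega_pow k vs = 0"
proof -
  have "0 = omega_pow (Suc k) (case_nat (H 1) (case_nat (H \<i>) vs))"
    using assms(1) by (simp add: omega_pow_above_dim)
  also have "\<dots> = 2 * real (Suc k) * omega (H 1) (H \<i>) * omega_pow k vs"
    using assms(2) by (intro omega_pow_Suc_orthogonal omega_H_W)
  finally show ?thesis
    using \<Delta>_pos by (simp add: omega_H L_H)
qed

text \<open>The Hamiltonian part of \<open>\<nu>\<close> is orthogonal to all of \<open>vs\<close>,
  and its part in \<open>W\<close> gives 2n vectors inside \<open>W\<close>, on which the top power
  vanishes.\<close>

lemma omega_pow_W_ker: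
  assumes k: "CARD('n) = Suc k" and vs: "\<And>i. i \<le> 2*k \<Longrightarrow> vs i \<in> W"
  shows "omega_pow (Suc k) (case_nat \<nu> vs) = 0"
proof -
  obtain \<zeta> w where \<nu>: "\<nu> = H \<zeta> + w" and w: "w \<in> W" using W_decomp by blast
  have "omega_pow (Suc k) (case_nat (H \<zeta>) vs) = 0"
    using vs by (intro omega_pow_Suc_orthogonal_all omega_H_W)
  moreover have "omega_pow (Suc k) (case_nat w vs) = 0"
    using vs w k by (intro omega_pow_W) (auto split: nat.split)
  ultimately show ?thesis
    by (simp add: \<nu> linear_add[OF linear_omega_pow_first])
qed

text \<open>Modulo \<open>W\<close>, the vector \<open>X\<close> is Hamiltonian, so it is orthogonal
  to \<open>p\<close> and \<open>vs\<close> and pairs only with \<open>\<nu>\<close>. The resulting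
  factor is positive for non-zero \<open>z\<close>: this is the comparison of orientations.\<close>

lemma omega_pow_transverse:
  assumes n: "CARD('n) = Suc (Suc k)" and p: "p \<in> W" and vs: "\<And>i. i \<le> 2*k \<Longrightarrow> vs i \<in> W"
    and X: "L X = \<i> * z" and \<nu>: "L \<nu> = - z"
  shows "omega_pow (Suc (Suc k)) (case_nat p (case_nat X (case_nat \<nu> vs)))
    = 8 * real (Suc (Suc k)) * (cmod z)\<^sup>2 / \<Delta> * omega_pow (Suc k) (case_nat p vs)"
proof -
  \<comment> \<open>Chosen so that \<open>L (H \<zeta>) = \<i> * z\<close>, the value of
    \<open>L X\<close>.\<close>
  define \<zeta> where "\<zeta> = - z / of_real \<Delta>"
  define w where "w = X - H \<zeta>"
  have "w \<in> W"
    using \<Delta>_pos by (simp add: W_def w_def linear_diff[OF linear_real_linear_form] X L_H \<zeta>_def)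
  let ?F = "\<lambda>x. omega_pow (Suc (Suc k)) (case_nat x (case_nat \<nu> (case_nat p vs)))"
  have "omega_pow (Suc (Suc k)) (case_nat p (case_nat X (case_nat \<nu> vs))) = ?F X"
    \<comment> \<open>Moving \<open>p\<close> behind \<open>X\<close> and \<open>\<nu>\<close> takes
      two swaps, so no sign appears.\<close>
    by (subst omega_pow_swap01, subst omega_pow_swap12) simp_all
  also have "\<dots> = ?F (H \<zeta>) + ?F w"
    by (simp add: w_def flip: linear_add[OF linear_omega_pow_first])
  also have "?F w = 0"
  proof (subst omega_pow_swap01, subst omega_pow_W_ker)
    fix i assume "i \<le> 2 * Suc k"
    then show "case_nat w (case_nat p vs) i \<in> W"
      using p vs \<open>w \<in> W\<close> by (auto split: nat.split)
  qed (use n in simp_all)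
  also have "?F (H \<zeta>) = 2 * real (Suc (Suc k)) * omega (H \<zeta>) \<nu> * omega_pow (Suc k) (case_nat p vs)"
    by (rule omega_pow_Suc_orthogonal, rule omega_H_W) (use p vs in \<open>auto split: nat.split\<close>)
  also have "omega (H \<zeta>) \<nu> = 4 * (cmod z)\<^sup>2 / \<Delta>"
    unfolding cmod_power2 by (simp add: omega_H \<nu> \<zeta>_def power2_eq_square Re_divide_of_real Im_divide_of_real add_divide_distrib)
  finally show ?thesis by simp
qed

text \<open>The vectors \<open>p\<close> and \<open>i p\<close> form a non-degenerate pair in
  \<open>W\<close>; their complement \<open>S'\<close> is symplectic of dimension at least 2k. The
  tuple consists of \<open>i p\<close>, the Reeb direction, followed by vectors of
  \<open>S'\<close>, all tangent to the sphere.\<close>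

lemma alpha_omega_pow_nonzero:
  assumes n: "CARD('n) = Suc (Suc k)" and p: "p \<noteq> 0" "p \<in> W" "(\<chi> j. \<i> * p$j) \<in> W"
  shows "\<exists>vs. (\<forall>i. vs i \<in> W \<and> inner p (vs i) = 0) \<and> alpha_omega_pow k p vs \<noteq> 0"
proof -
  let ?q = "\<chi> j. \<i> * p$j"
  have pq: "omega p ?q \<noteq> 0" using p(1) by (simp add: omega_times_ii)
  define S' where "S' = {u\<in>W. omega p u = 0 \<and> omega ?q u = 0}"
  have "symplectic_subspace S'" "dim W \<le> dim S' + 2"
    unfolding S'_def using symplectic_subspace_complement[OF symplectic_W p(2,3) pq] by auto
  then obtain vs where vs: "\<forall>i. vs i \<in> S'" "omega_pow k vs \<noteq> 0"
    using symplectic_subspace_omega_pow[of S' k] dim_W n by auto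
  have "omega_pow (Suc k) (case_nat p (case_nat ?q vs)) \<noteq> 0"
    using vs pq by (subst omega_pow_Suc_orthogonal) (auto simp: S'_def)
  then have "alpha_omega_pow k p (case_nat ?q vs) \<noteq> 0"
    by (simp add: alpha_omega_pow_eq)
  moreover have "case_nat ?q vs i \<in> W" for i
    using p vs by (auto simp: S'_def split: nat.split)
  moreover have "inner p (case_nat ?q vs i) = 0" for i
  proof -
    have "inner p u = 0" if "u \<in> S'" for u
      using that omega_times_ii_inner[of u p] omega_anticommute[of u ?q] by (simp add: S'_def)
    moreover have "inner p ?q = 0"
      using omega_times_ii_inner[of ?q p] by simp
    ultimately show ?thesis using vs(1) by (auto split: nat.split)
  qed
  ultimately show ?thesis by blast
qed

end

subsection \<open>Polynomials and mixed polynomials\<close>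

lemma has_derivative_vec_lambda:
  fixes f :: "'n::finite \<Rightarrow> 'a::real_normed_vector \<Rightarrow> 'b::euclidean_space"
  assumes "\<And>j. (f j has_derivative f' j) (at x)"
  shows "((\<lambda>x. \<chi> j. f j x) has_derivative (\<lambda>v. \<chi> j. f' j v)) (at x)"
proof -
  have sum_axis: "(\<chi> j. g j) = (\<Sum>j\<in>UNIV. axis j (g j))" for g :: "'n \<Rightarrow> 'b"
    by (simp add: vec_eq_iff axis_def sum.delta' if_distrib cong: if_cong)
  have "bounded_linear (axis j :: 'b \<Rightarrow> 'b^'n)" for j
    unfolding linear_conv_bounded_linear[symmetric]
    by (rule linearI) (simp_all add: vec_eq_iff axis_def)
  from bounded_linear.has_derivative[OF this assms] show ?thesis
    unfolding sum_axis by (rule has_derivative_sum)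
qed

text \<open>The vector \<open>D\<close> is the complex gradient; later arguments use it only through
  this complex-linear derivative. For infinite support both sums over the support are 0 by
  convention.\<close>

lemma peval_has_derivative:
  fixes c :: "nat^'n \<Rightarrow> complex"
  shows "\<exists>D. (peval c has_derivative (\<lambda>v. \<Sum>j\<in>UNIV. D$j * v$j)) (at z)"
proof -
  let ?m = "\<lambda>\<nu> j. of_nat (\<nu>$j) * z$j ^ (\<nu>$j - 1) * (\<Prod>k\<in>UNIV-{j}. z$k ^ (\<nu>$k))"
  have nth: "((\<lambda>x::complex^'n. x$j) has_derivative (\<lambda>v. v$j)) (at z)" for j
    by (rule bounded_linear_imp_has_derivative[OF bounded_linear_vec_nth])
  have mono: "(monomial_val \<nu> has_derivative (\<lambda>v. \<Sum>j\<in>UNIV. ?m \<nu> j * v$j)) (at z)" for \<nu> :: "nat^'n"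
    unfolding monomial_val_def[abs_def]
    by (rule has_derivative_eq_rhs, rule has_derivative_prod, rule has_derivative_power, rule nth)
      (simp add: fun_eq_iff mult_ac)
  have "(peval c has_derivative
      (\<lambda>v. \<Sum>\<nu>\<in>coeff_supp c. c \<nu> * (\<Sum>j\<in>UNIV. ?m \<nu> j * v$j))) (at z)"
    unfolding peval_def[abs_def] by (intro has_derivative_sum has_derivative_mult_right mono)
  moreover have "(\<Sum>\<nu>\<in>coeff_supp c. c \<nu> * (\<Sum>j\<in>UNIV. ?m \<nu> j * v$j))
      = (\<Sum>j\<in>UNIV. (\<chi> j. \<Sum>\<nu>\<in>coeff_supp c. c \<nu> * ?m \<nu> j)$j * v$j)" for v :: "complex^'n"
    unfolding vec_lambda_beta sum_distrib_left sum_distrib_right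
    by (subst sum.swap) (simp add: mult.assoc)
  ultimately show ?thesis
    by (intro exI[of _ "\<chi> j. \<Sum>\<nu>\<in>coeff_supp c. c \<nu> * ?m \<nu> j"]) (simp only:)
qed

lemma peval_scaleR:
  assumes "homogeneous_poly c d"
  shows "peval c (t *\<^sub>R z) = of_real t ^ d * peval c z"
proof -
  have "monomial_val \<nu> (t *\<^sub>R z) = of_real t ^ d * monomial_val \<nu> z" if "\<nu> \<in> coeff_supp c" for \<nu>
  proof -
    have "monomial_val \<nu> (t *\<^sub>R z) = (\<Prod>j\<in>UNIV. of_real t ^ (\<nu>$j)) * monomial_val \<nu> z"
      unfolding monomial_val_def vector_scaleR_component
      by (simp add: scaleR_conv_of_real power_mult_distrib prod.distrib)
    moreover have "(\<Prod>j\<in>UNIV. (of_real t :: complex) ^ (\<nu>$j)) = of_real t ^ d"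
      using assms that by (simp add: homogeneous_poly_def total_deg_def flip: power_sum)
    ultimately show ?thesis by simp
  qed
  then show ?thesis by (simp add: peval_def sum_distrib_left mult_ac)
qed

text \<open>Differentiate \<open>peval c (t *\<^sub>R z)\<close> at t = 1, once by the chain rule
  and once through homogeneity.\<close>

lemma euler_identity:
  assumes "homogeneous_poly c d"
    and D: "(peval c has_derivative (\<lambda>v. \<Sum>j\<in>UNIV. D$j * v$j)) (at z)"
  shows "(\<Sum>j\<in>UNIV. D$j * z$j) = of_nat d * peval c z"
proof -
  have "((\<lambda>t::real. t *\<^sub>R z) has_derivative (\<lambda>s. s *\<^sub>R z)) (at 1)"
    by (auto intro!: derivative_eq_intros)
  from has_derivative_compose[OF this, of "peval c" "\<lambda>v. \<Sum>j\<in>UNIV. D$j * v$j"] D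
  have "((\<lambda>t. peval c (t *\<^sub>R z)) has_derivative (\<lambda>s. \<Sum>j\<in>UNIV. D$j * (s *\<^sub>R z)$j)) (at 1)"
    by simp
  then have "((\<lambda>t. of_real t ^ d * peval c z) has_derivative (\<lambda>s. \<Sum>j\<in>UNIV. D$j * (s *\<^sub>R z)$j)) (at 1)"
    by (simp only: peval_scaleR[OF assms(1)])
  moreover have "((\<lambda>t. of_real t ^ d * peval c z) has_derivative (\<lambda>s::real. of_nat d * of_real s * peval c z)) (at 1)"
    by (auto intro!: derivative_eq_intros)
  ultimately have "(\<lambda>s. \<Sum>j\<in>UNIV. D$j * (s *\<^sub>R z)$j) = (\<lambda>s. of_nat d * of_real s * peval c z)"
    by (rule has_derivative_unique)
  from fun_cong[OF this, of 1] show ?thesis by simp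
qed

text \<open>On the coordinate subspace of the non-vanishing coordinates of the point, the polynomial
  is the face function of the weight that is 1 on these coordinates and 2 on the others.\<close>

lemma nonzero_partial_derivative:
  fixes c :: "nat^'n \<Rightarrow> complex"
  assumes hom: "homogeneous_poly c d" and "convenient c" "nondegenerate c"
    and z: "z \<noteq> 0" "peval c z = 0"
    and D: "(peval c has_derivative (\<lambda>v. \<Sum>j\<in>UNIV. D$j * v$j)) (at z)"
  shows "\<exists>j. z$j \<noteq> 0 \<and> D$j \<noteq> 0"
proof (rule ccontr)
  assume "\<not> ?thesis"
  then have D0: "z$j = 0 \<or> D$j = 0" for j by blast
  define P :: "nat^'n" where "P = (\<chi> j. if z$j \<noteq> 0 then 1 else 2)"
  define proj :: "complex^'n \<Rightarrow> complex^'n" where "proj x = (\<chi> j. if z$j \<noteq> 0 then x$j else 0)" for x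
  have fin: "finite (coeff_supp c)" and deg: "\<And>\<nu>. \<nu> \<in> coeff_supp c \<Longrightarrow> total_deg \<nu> = d"
    using hom by (auto simp: homogeneous_poly_def)
  \<comment> \<open>The excess over the total degree is the exponent mass on the vanishing
    coordinates, so weight \<open>d\<close> singles out monomials free of them.\<close>
  have wdeg: "wdeg P \<nu> = total_deg \<nu> + (\<Sum>j\<in>UNIV. if z$j = 0 then \<nu>$j else 0)" for \<nu>
    unfolding wdeg_def total_deg_def sum.distrib[symmetric]
    by (rule sum.cong) (auto simp: P_def)
  have wdeg_eq: "wdeg P \<nu> = d \<longleftrightarrow> (\<forall>j. z$j = 0 \<longrightarrow> \<nu>$j = 0)" if "\<nu> \<in> coeff_supp c" for \<nu>
    using deg[OF that] by (auto simp: wdeg)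
  obtain j where j: "z$j \<noteq> 0" using z(1) by (auto simp: vec_eq_iff)
  obtain m where m: "c (\<chi> k. if k = j then m else 0) \<noteq> 0"
    using \<open>convenient c\<close> unfolding convenient_def by blast
  let ?e = "\<chi> k. if k = j then m else 0"
  have e: "?e \<in> coeff_supp c" using m by (simp add: coeff_supp_def)
  have "wdeg P ?e = d" using wdeg_eq[OF e] j by auto
  \<comment> \<open>Convenience supplies a pure power in a non-vanishing coordinate, which attains
    the lower bound \<open>d\<close>.\<close>
  then have Min: "Min (wdeg P ` coeff_supp c) = d"
    using e fin deg by (intro Min_eqI) (auto simp: wdeg)
  have face: "peval (face_poly P c) x = peval c (proj x)" for x
  proof -
    let ?S = "{\<nu>\<in>coeff_supp c. \<forall>j. z$j = 0 \<longrightarrow> \<nu>$j = 0}"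
    have S: "coeff_supp (face_poly P c) = ?S"
      unfolding face_poly_def Min using wdeg_eq by (auto simp: coeff_supp_def)
    have "peval (face_poly P c) x = (\<Sum>\<nu>\<in>?S. c \<nu> * monomial_val \<nu> x)"
      unfolding peval_def S by (rule sum.cong) (use Min wdeg_eq in \<open>auto simp: face_poly_def\<close>)
    also have "\<dots> = (\<Sum>\<nu>\<in>?S. c \<nu> * monomial_val \<nu> (proj x))"
    proof (rule sum.cong[OF refl])
      fix \<nu> assume "\<nu> \<in> ?S"
      then have "x$j ^ (\<nu>$j) = proj x$j ^ (\<nu>$j)" for j
        by (auto simp: proj_def)
      then show "c \<nu> * monomial_val \<nu> x = c \<nu> * monomial_val \<nu> (proj x)"
        by (simp add: monomial_val_def)
    qed
    also have "\<dots> = peval c (proj x)"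
      unfolding peval_def
    proof (rule sum.mono_neutral_left[OF fin], blast, rule ballI)
      fix \<nu> assume "\<nu> \<in> coeff_supp c - ?S"
      then obtain i where "z$i = 0" "\<nu>$i \<noteq> 0" by blast
      then have "proj x$i ^ (\<nu>$i) = 0" by (simp add: proj_def)
      then have "monomial_val \<nu> (proj x) = 0"
        unfolding monomial_val_def by (intro prod_zero bexI[of _ i]) simp_all
      then show "c \<nu> * monomial_val \<nu> (proj x) = 0" by simp
    qed
    finally show ?thesis .
  qed
  \<comment> \<open>Filling the zero coordinates with 1 gives a point of the torus over
    \<open>z\<close>. The face function factors through \<open>proj\<close>, so \<open>z'\<close> is
    a zero and a critical point of it.\<close>
  define z' :: "complex^'n" where "z' = (\<chi> j. if z$j \<noteq> 0 then z$j else 1)"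
  have pz: "proj z' = z" by (auto simp: vec_eq_iff proj_def z'_def)
  have "(proj has_derivative proj) (at z')"
    by (intro linear_imp_has_derivative linearI) (auto simp: proj_def vec_eq_iff)
  from has_derivative_compose[OF this, of "peval c" "\<lambda>v. \<Sum>j\<in>UNIV. D$j * v$j"] D
  have "((\<lambda>x. peval c (proj x)) has_derivative (\<lambda>v. \<Sum>j\<in>UNIV. D$j * proj v$j)) (at z')"
    by (simp add: pz)
  moreover have "(\<lambda>v. \<Sum>j\<in>UNIV. D$j * proj v$j) = (\<lambda>_. 0)"
  proof (intro ext sum.neutral ballI)
    fix v j show "D$j * proj v$j = 0" using D0[of j] by (auto simp: proj_def)
  qed
  moreover have "peval (face_poly P c) = (\<lambda>x. peval c (proj x))"
    using face by auto
  ultimately have "(peval (face_poly P c) has_derivative (\<lambda>_. 0)) (at z')"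
    "peval (face_poly P c) z' = 0"
    using z(2) by (simp_all add: pz)
  moreover have "\<forall>j. z'$j \<noteq> 0" "\<forall>j. P$j > 0" by (auto simp: z'_def P_def)
  ultimately show False using \<open>nondegenerate c\<close> unfolding nondegenerate_def by blast
qed

section \<open>Wirtinger derivatives of the mixed polynomial\<close>

definition mix :: "nat \<Rightarrow> nat \<Rightarrow> complex^'n \<Rightarrow> complex^'n" where
  "mix a b w = (\<chi> j. (w$j)^a * (cnj (w$j))^b)"

definition gmix_holo_part :: "nat \<Rightarrow> nat \<Rightarrow> complex^'n \<Rightarrow> complex^'n \<Rightarrow> complex^'n" where
  "gmix_holo_part a b D w = (\<chi> j. D$j * (of_nat a * (w$j)^(a-1) * (cnj (w$j))^b))"

definition gmix_antiholo_part :: "nat \<Rightarrow> nat \<Rightarrow> complex^'n \<Rightarrow> complex^'n \<Rightarrow> complex^'n" where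
  "gmix_antiholo_part a b D w = (\<chi> j. D$j * (of_nat b * (w$j)^a * (cnj (w$j))^(b-1)))"

lemma gmix_has_derivative:
  fixes c :: "nat^'n \<Rightarrow> complex"
  assumes D: "(peval c has_derivative (\<lambda>v. \<Sum>j\<in>UNIV. D$j * v$j)) (at (mix a b w))"
  shows "(gmix a b c has_derivative real_linear_form (gmix_holo_part a b D w) (gmix_antiholo_part a b D w)) (at w)"
proof -
  have nth: "((\<lambda>x::complex^'n. x$j) has_derivative (\<lambda>v. v$j)) (at w)" for j
    by (rule bounded_linear_imp_has_derivative[OF bounded_linear_vec_nth])
  have "(mix a b has_derivative (\<lambda>v. \<chi> j. of_nat a * (w$j)^(a-1) * (cnj (w$j))^b * v$j
      + of_nat b * (w$j)^a * (cnj (w$j))^(b-1) * cnj (v$j))) (at w)"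
    unfolding mix_def[abs_def]
    by (rule has_derivative_vec_lambda)
      (auto intro!: derivative_eq_intros nth simp: algebra_simps)
  from has_derivative_compose[OF this D]
  have "((\<lambda>w. peval c (mix a b w)) has_derivative
      (\<lambda>v. \<Sum>j\<in>UNIV. D$j * (of_nat a * (w$j)^(a-1) * (cnj (w$j))^b * v$j
        + of_nat b * (w$j)^a * (cnj (w$j))^(b-1) * cnj (v$j)))) (at w)" by simp
  moreover have "gmix a b c = (\<lambda>w. peval c (mix a b w))"
    by (simp add: gmix_def mix_def fun_eq_iff)
  moreover have "real_linear_form (gmix_holo_part a b D w) (gmix_antiholo_part a b D w) =
      (\<lambda>v. \<Sum>j\<in>UNIV. D$j * (of_nat a * (w$j)^(a-1) * (cnj (w$j))^b * v$j
        + of_nat b * (w$j)^a * (cnj (w$j))^(b-1) * cnj (v$j)))"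
    by (simp add: real_linear_form_def gmix_holo_part_def gmix_antiholo_part_def fun_eq_iff algebra_simps)
  ultimately show ?thesis by (simp only:)
qed

text \<open>Componentwise both moduli are \<open>cmod (D$i) * cmod (w$i) ^ (a + b - 1)\<close>,
  times \<open>b\<close> and \<open>a\<close> respectively; the component \<open>j\<close> makes the
  inequality strict.\<close>

lemma norm_antiholo_part_less:
  assumes "b < a" and j: "w$j \<noteq> 0" "D$j \<noteq> 0"
  shows "norm (gmix_antiholo_part a b D w) < norm (gmix_holo_part a b D w)"
proof -
  let ?A = "gmix_holo_part a b D w" and ?B = "gmix_antiholo_part a b D w"
  have A: "cmod (?A$i) = cmod (D$i) * real a * cmod (w$i) ^ (a + b - 1)" for i
    using assms(1) by (simp add: gmix_holo_part_def norm_mult norm_power power_add[symmetric])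
  have B: "cmod (?B$i) = cmod (D$i) * real b * cmod (w$i) ^ (a + b - 1)" for i
  \<comment> \<open>For \<open>b = 0\<close> the truncated exponents differ, but the factor
    \<open>b\<close> makes both sides 0.\<close>
  proof (cases "b = 0")
    case False
    then have "a + (b - 1) = a + b - 1" by simp
    then show ?thesis by (simp add: gmix_antiholo_part_def norm_mult norm_power power_add[symmetric] mult.assoc)
  qed (simp add: gmix_antiholo_part_def)
  have "cmod (?B$i) \<le> cmod (?A$i)" for i
    unfolding A B using assms(1) by (intro mult_right_mono mult_left_mono) auto
  moreover have "cmod (?B$j) < cmod (?A$j)"
    unfolding A B using assms by (intro mult_strict_right_mono mult_strict_left_mono) auto
  ultimately have "(\<Sum>i\<in>UNIV. (cmod (?B$i))\<^sup>2) < (\<Sum>i\<in>UNIV. (cmod (?A$i))\<^sup>2)"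
    by (intro sum_strict_mono_ex1) (auto intro!: power_mono exI[of _ j] power_strict_mono)
  then show ?thesis by (simp add: norm_vec_def L2_set_def)
qed

text \<open>Each summand reproduces \<open>D$j * mix a b w$j\<close> with factor \<open>a\<close> or
  \<open>b\<close>. Rotation by i changes the sign of the antilinear summand, so the factors add in
  the radial direction and subtract in the circular one.\<close>

lemma real_linear_form_radial:
  assumes "b < a"
  shows "real_linear_form (gmix_holo_part a b D w) (gmix_antiholo_part a b D w) w
    = of_nat (a + b) * (\<Sum>j\<in>UNIV. D$j * mix a b w$j)" (is ?rad)
    and "real_linear_form (gmix_holo_part a b D w) (gmix_antiholo_part a b D w) (\<chi> j. \<i> * w$j)
    = \<i> * of_nat (a - b) * (\<Sum>j\<in>UNIV. D$j * mix a b w$j)" (is ?rot)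
proof -
  have A: "gmix_holo_part a b D w$j * w$j = of_nat a * (D$j * mix a b w$j)" for j
    using assms by (cases a) (simp_all add: gmix_holo_part_def mix_def mult_ac)
  have B: "gmix_antiholo_part a b D w$j * cnj (w$j) = of_nat b * (D$j * mix a b w$j)" for j
    by (cases b) (simp_all add: gmix_antiholo_part_def mix_def mult_ac)
  show ?rad
    by (simp add: real_linear_form_def A B sum.distrib distrib_right flip: sum_distrib_left)
  have "gmix_holo_part a b D w$j * (\<i> * w$j) + gmix_antiholo_part a b D w$j * cnj (\<i> * w$j) =
      \<i> * of_nat (a - b) * (D$j * mix a b w$j)" for j
  proof -
    have "gmix_holo_part a b D w$j * (\<i> * w$j) + gmix_antiholo_part a b D w$j * cnj (\<i> * w$j) =
        \<i> * (gmix_holo_part a b D w$j * w$j - gmix_antiholo_part a b D w$j * cnj (w$j))" by (simp add: algebra_simps)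
    also have "\<dots> = \<i> * (of_nat a - of_nat b) * (D$j * mix a b w$j)"
      unfolding A B by (simp only: left_diff_distrib mult.assoc)
    finally show ?thesis using assms by (simp add: of_nat_diff)
  qed
  then show ?rot
    by (simp add: real_linear_form_def flip: sum_distrib_left)
qed

text \<open>Here \<open>theta g\<close> is \<open>g\<close> times a positive real function. The
  derivative \<open>N\<close> of that function contributes a real multiple of
  \<open>g w * cnj (g w)\<close>, which \<open>Im\<close> removes.\<close>

lemma theta_differentiable:
  assumes G: "(g has_derivative G) (at w)" and "g w \<noteq> 0"
  shows "theta g differentiable (at w)"
    and "Im (cnj (theta g w) * frechet_derivative (theta g) (at w) v) = Im (cnj (g w) * G v) / (cmod (g w))\<^sup>2"
proof -
  have "((\<lambda>x. cmod (g x)) has_derivative (\<lambda>h. inner (G h) (sgn (g w)))) (at w)"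
    by (rule has_derivative_compose[OF G has_derivative_norm[OF assms(2)]])
  then have "((\<lambda>x. inverse (cmod (g x))) has_derivative
      (\<lambda>h. - (inverse (cmod (g w)) * inner (G h) (sgn (g w)) * inverse (cmod (g w))))) (at w)"
    using assms(2) by (intro Deriv.has_derivative_inverse) simp_all
  then obtain N where N: "((\<lambda>x. inverse (cmod (g x))) has_derivative N) (at w)" by blast
  have "theta g = (\<lambda>x. g x * of_real (inverse (cmod (g x))))"
    by (simp add: theta_def fun_eq_iff field_simps)
  then have D: "(theta g has_derivative
      (\<lambda>h. g w * of_real (N h) + G h * of_real (inverse (cmod (g w))))) (at w)"
    using has_derivative_mult[OF G has_derivative_of_real[OF N]] by simp
  then show "theta g differentiable (at w)" by (rule differentiableI)
  have "frechet_derivative (theta g) (at w) v = g w * of_real (N v) + G v * of_real (inverse (cmod (g w)))"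
    using frechet_derivative_at[OF D] by metis
  then have "cnj (theta g w) * frechet_derivative (theta g) (at w) v =
      of_real (N v / cmod (g w)) * (g w * cnj (g w)) + of_real (1 / (cmod (g w))\<^sup>2) * (cnj (g w) * G v)"
    using assms(2) by (simp add: theta_def power2_eq_square field_simps)
  then show "Im (cnj (theta g w) * frechet_derivative (theta g) (at w) v) = Im (cnj (g w) * G v) / (cmod (g w))\<^sup>2"
    by (simp add: add_divide_distrib diff_divide_distrib algebra_simps)
qed

section \<open>Verification of the three carrying conditions\<close>

theorem theorem19:
  fixes c :: "nat^'n \<Rightarrow> complex" and d a b :: nat
  assumes "CARD('n) \<ge> 2"
    and "d > 0"
    and "homogeneous_poly c d"
    and "convenient c"
    and "nondegenerate c"
    and "a > b"
  shows "\<forall>r::real. r > 0 \<longrightarrow> contact_form_carried_by_milnor_open_book (gmix a b c) r"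
proof (intro allI impI)
  fix r :: real assume r: "r > 0"
  let ?g = "gmix a b c"
  obtain k where n: "CARD('n) = Suc (Suc k)"
    using assms(1) by (metis Suc_le_D numeral_2_eq_2 Suc_le_mono)
  then have k: "CARD('n) - 2 = k" by simp
  have g_mix: "?g w = peval c (mix a b w)" for w by (simp add: gmix_def mix_def)
  have partials: "\<exists>D. (peval c has_derivative (\<lambda>v. \<Sum>j\<in>UNIV. D$j * v$j)) (at z)" for z
    by (rule peval_has_derivative)
  have local_structure: "\<exists>A B. norm B < norm A \<and> (?g has_derivative real_linear_form A B) (at p) \<and>
      real_linear_form A B p = 0 \<and> real_linear_form A B (\<chi> j. \<i> * p$j) = 0"
    if p: "p \<in> binding ?g r" for p
  proof -
    obtain D where D: "(peval c has_derivative (\<lambda>v. \<Sum>j\<in>UNIV. D$j * v$j)) (at (mix a b p))"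
      using partials by blast
    have "p \<noteq> 0" "?g p = 0" using p r by (auto simp: binding_def)
    then obtain i where "p$i \<noteq> 0" by (auto simp: vec_eq_iff)
    then have "mix a b p$i \<noteq> 0" by (simp add: mix_def)
    then have "mix a b p \<noteq> 0" by auto
    then obtain j where "mix a b p$j \<noteq> 0" "D$j \<noteq> 0"
      using nonzero_partial_derivative[OF assms(3-5) _ _ D] \<open>?g p = 0\<close> g_mix by auto
    then have "norm (gmix_antiholo_part a b D p) < norm (gmix_holo_part a b D p)"
      using assms(6) by (intro norm_antiholo_part_less) (auto simp: mix_def power_0_left)
    moreover have "(\<Sum>j\<in>UNIV. D$j * mix a b p$j) = 0"
      using euler_identity[OF assms(3) D] \<open>?g p = 0\<close> g_mix by simp
    ultimately show ?thesis
      using gmix_has_derivative[OF D] real_linear_form_radial[OF assms(6), of D p]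
      by (intro exI[of _ "gmix_holo_part a b D p"] exI[of _ "gmix_antiholo_part a b D p"]) simp
  qed
  have cond1: "regular_binding_pt ?g p \<and>
        (\<exists>vs. (\<forall>i\<le>2*k. vs i \<in> tangent_binding ?g p) \<and> alpha_omega_pow k p vs \<noteq> 0)"
    if p: "p \<in> binding ?g r" for p
  proof -
    obtain A B where AB: "norm B < norm A" and der: "(?g has_derivative real_linear_form A B) (at p)"
      and rad: "real_linear_form A B p = 0" "real_linear_form A B (\<chi> j. \<i> * p$j) = 0"
      using local_structure[OF p] by blast
    interpret antilinear_dominated A B by unfold_locales (rule AB)
    have fd: "frechet_derivative ?g (at p) = L" using frechet_derivative_at[OF der] by simp
    have p0: "p \<noteq> 0" using p r by (auto simp: binding_def)
    have "\<exists>v. inner p v = t \<and> L v = z" for t z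
    proof -
      let ?h = "H (\<i> * z / of_real \<Delta>)"
      \<comment> \<open>The Hamiltonian vector attains the value \<open>z\<close>; since
        \<open>p\<close> lies in the kernel of \<open>L\<close>, a multiple of it adjusts the radial
        component freely.\<close>
      let ?v = "?h + ((t - inner p ?h) / inner p p) *\<^sub>R p"
      have "L ?v = z"
        by (simp add: linear_add[OF linear_real_linear_form] linear_cmul[OF linear_real_linear_form] rad L_surj)
      moreover have "inner p ?v = t" using p0 by (simp add: inner_add_right)
      ultimately show ?thesis by blast
    qed
    then have "regular_binding_pt ?g p"
      using der by (auto simp: regular_binding_pt_def fd differentiableI)
    moreover have "p \<in> W" "(\<chi> j. \<i> * p$j) \<in> W" using rad by (simp_all add: W_def)
    then obtain vs where "\<forall>i. vs i \<in> W \<and> inner p (vs i) = 0" "alpha_omega_pow k p vs \<noteq> 0"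
      using alpha_omega_pow_nonzero[OF n p0] by blast
    then have "\<exists>vs. (\<forall>i\<le>2*k. vs i \<in> tangent_binding ?g p) \<and> alpha_omega_pow k p vs \<noteq> 0"
      by (intro exI[of _ vs]) (simp add: tangent_binding_def fd W_def)
    ultimately show ?thesis ..
  qed
  have cond2: "theta ?g differentiable (at w) \<and>
        Im (cnj (theta ?g w) * frechet_derivative (theta ?g) (at w) (reeb r w)) > 0"
    if w: "w \<in> sphere 0 r - binding ?g r" for w
  proof -
    obtain D where D: "(peval c has_derivative (\<lambda>v. \<Sum>j\<in>UNIV. D$j * v$j)) (at (mix a b w))"
      using partials by blast
    let ?G = "real_linear_form (gmix_holo_part a b D w) (gmix_antiholo_part a b D w)"
    have g0: "?g w \<noteq> 0" using w by (auto simp: binding_def)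
    have G: "(?g has_derivative ?G) (at w)" by (rule gmix_has_derivative[OF D])
    have "reeb r w = (1 / (2 * r\<^sup>2)) *\<^sub>R (\<chi> j. \<i> * w$j)"
      by (simp add: reeb_def vec_eq_iff complex_eq_iff)
    then have "?G (reeb r w) = (1 / (2 * r\<^sup>2)) *\<^sub>R (\<i> * of_nat (a - b) * (of_nat d * ?g w))"
      using real_linear_form_radial(2)[OF assms(6), of D w] euler_identity[OF assms(3) D]
      by (simp add: linear_cmul[OF linear_real_linear_form] g_mix)
    then have "cnj (?g w) * ?G (reeb r w) =
        (real (a - b) * real d / (2 * r\<^sup>2)) *\<^sub>R (\<i> * (?g w * cnj (?g w)))"
      by (simp add: scaleR_conv_of_real mult_ac)
    \<comment> \<open>After division by \<open>(cmod (?g w))\<^sup>2\<close> the angle grows along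
      the Reeb field at the constant rate \<open>(a - b) * d / (2 * r\<^sup>2)\<close>.\<close>
    then have "Im (cnj (?g w) * ?G (reeb r w)) = real (a - b) * real d / (2 * r\<^sup>2) * (cmod (?g w))\<^sup>2"
      by (simp add: complex_norm_square[symmetric] del: complex_cnj_mult of_real_power)
    also have "\<dots> > 0" using assms(2,6) g0 r by simp
    finally show ?thesis
      using theta_differentiable[OF G g0] g0 by simp
  qed
  have cond3: "sgn (alpha_omega_pow k p vs) = sgn (omega_pow (Suc (Suc k))
      (\<lambda>i. if i = 0 then p else if i = 1 then X else if i = 2 then \<nu> else vs (i - 3)))"
    if p: "p \<in> binding ?g r" and vs: "\<forall>i\<le>2*k. vs i \<in> tangent_binding ?g p" and z: "z \<noteq> 0"
      and X: "frechet_derivative ?g (at p) X = \<i> * z" and \<nu>: "frechet_derivative ?g (at p) \<nu> = - z"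
    for p vs z X \<nu>
  proof -
    obtain A B where AB: "norm B < norm A" and der: "(?g has_derivative real_linear_form A B) (at p)"
      and rad: "real_linear_form A B p = 0"
      using local_structure[OF p] by blast
    interpret antilinear_dominated A B by unfold_locales (rule AB)
    have fd: "frechet_derivative ?g (at p) = L" using frechet_derivative_at[OF der] by simp
    have "(\<lambda>i. if i = 0 then p else if i = 1 then X else if i = 2 then \<nu> else vs (i - 3))
        = case_nat p (case_nat X (case_nat \<nu> vs))"
      by (auto simp: fun_eq_iff numeral_eq_Suc split: nat.split)
    moreover have "omega_pow (Suc (Suc k)) (case_nat p (case_nat X (case_nat \<nu> vs)))
        = 8 * real (Suc (Suc k)) * (cmod z)\<^sup>2 / \<Delta> * omega_pow (Suc k) (case_nat p vs)"
      by (rule omega_pow_transverse[OF n])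
        (use rad vs X \<nu> in \<open>auto simp: fd W_def tangent_binding_def\<close>)
    \<comment> \<open>Both sides are positive multiples of
      \<open>omega_pow (Suc k) (case_nat p vs)\<close>.\<close>
    ultimately show ?thesis
      using z \<Delta>_pos by (simp add: alpha_omega_pow_eq sgn_mult sgn_divide)
  qed
  have "carry_cond1 ?g r"
    unfolding carry_cond1_def k using cond1 by blast
  moreover have "carry_cond2 ?g r"
    unfolding carry_cond2_def using cond2 by blast
  moreover have "carry_cond3 ?g r"
    unfolding carry_cond3_def k unfolding n
    by (intro ballI allI impI, elim conjE, rule cond3)
  ultimately show "contact_form_carried_by_milnor_open_book ?g r"
    unfolding contact_form_carried_by_milnor_open_book_def by blast
qed

end
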